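(* For every non-constant slice regular function $f:\mathbb{H}\to\mathbb{H}$ the image $f(\mathbb{H})$ is dense in $\mathbb{H}$.
   Context: $\mathbb{H}$ denotes the skew field of quaternions with the Euclidean topology of $\mathbb{R}^4$. A slice regular function $f:\mathbb{H}\to\mathbb{H}$ (entire slice regular function) is a function given by a globally convergent power series $f(q)=\sum_{k=0}^{\infty}q^k a_k$ with coefficients $a_k\in\mathbb{H}$ (on the right). *)

theory Defs
  imports "HOL-Analysis.Analysis"
begin

section \<open>The skew field of quaternions\<close>

text \<open>
  \<open>Quat a b c d\<close> stands for \<open>a + b i + c j + d k\<close>. As for the type of complex numbers, a
  codatatype is used so that operations can be given componentwise.
\<close>

codatatype quat = Quat (QRe: real) (QI: real) (QJ: real) (QK: real)

lemma quat_eqI [intro?]: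
  "QRe x = QRe y \<Longrightarrow> QI x = QI y \<Longrightarrow> QJ x = QJ y \<Longrightarrow> QK x = QK y \<Longrightarrow> x = y"
  by (rule quat.expand) simp

lemma quat_eq_iff:
  "x = y \<longleftrightarrow> QRe x = QRe y \<and> QI x = QI y \<and> QJ x = QJ y \<and> QK x = QK y"
  by (auto intro: quat.expand)

instantiation quat :: ab_group_add
begin

primcorec zero_quat where
  "QRe 0 = 0" | "QI 0 = 0" | "QJ 0 = 0" | "QK 0 = 0"

primcorec plus_quat where
  "QRe (x + y) = QRe x + QRe y"
| "QI (x + y) = QI x + QI y"
| "QJ (x + y) = QJ x + QJ y"
| "QK (x + y) = QK x + QK y"

primcorec uminus_quat where
  "QRe (- x) = - QRe x"
| "QI (- x) = - QI x"
| "QJ (- x) = - QJ x"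
| "QK (- x) = - QK x"

primcorec minus_quat where
  "QRe (x - y) = QRe x - QRe y"
| "QI (x - y) = QI x - QI y"
| "QJ (x - y) = QJ x - QJ y"
| "QK (x - y) = QK x - QK y"

instance
  by standard (simp_all add: quat_eq_iff)

end

instantiation quat :: ring_1
begin

primcorec one_quat where
  "QRe 1 = 1" | "QI 1 = 0" | "QJ 1 = 0" | "QK 1 = 0"

primcorec times_quat where
  "QRe (x * y) = QRe x * QRe y - QI x * QI y - QJ x * QJ y - QK x * QK y"
| "QI (x * y) = QRe x * QI y + QI x * QRe y + QJ x * QK y - QK x * QJ y"
| "QJ (x * y) = QRe x * QJ y - QI x * QK y + QJ x * QRe y + QK x * QI y"
| "QK (x * y) = QRe x * QK y + QI x * QJ y - QJ x * QI y + QK x * QRe y"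

instance
  by standard (simp_all add: quat_eq_iff algebra_simps)

end

instantiation quat :: real_algebra_1
begin

primcorec scaleR_quat where
  "QRe (scaleR r x) = r * QRe x"
| "QI (scaleR r x) = r * QI x"
| "QJ (scaleR r x) = r * QJ x"
| "QK (scaleR r x) = r * QK x"

instance
  by standard (simp_all add: quat_eq_iff algebra_simps)

end

lemma quat_sum_squares_eq_0_iff:
  "(QRe x)\<^sup>2 + (QI x)\<^sup>2 + (QJ x)\<^sup>2 + (QK x)\<^sup>2 = 0 \<longleftrightarrow> x = 0"
proof
  assume "(QRe x)\<^sup>2 + (QI x)\<^sup>2 + (QJ x)\<^sup>2 + (QK x)\<^sup>2 = 0"
  then have "(QRe x)\<^sup>2 = 0 \<and> (QI x)\<^sup>2 = 0 \<and> (QJ x)\<^sup>2 = 0 \<and> (QK x)\<^sup>2 = 0"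
    by (smt (verit) zero_le_power2)
  then show "x = 0"
    by (simp add: quat_eq_iff)
qed simp

instantiation quat :: real_div_algebra
begin

primcorec inverse_quat where
  "QRe (inverse x) = QRe x / ((QRe x)\<^sup>2 + (QI x)\<^sup>2 + (QJ x)\<^sup>2 + (QK x)\<^sup>2)"
| "QI (inverse x) = - QI x / ((QRe x)\<^sup>2 + (QI x)\<^sup>2 + (QJ x)\<^sup>2 + (QK x)\<^sup>2)"
| "QJ (inverse x) = - QJ x / ((QRe x)\<^sup>2 + (QI x)\<^sup>2 + (QJ x)\<^sup>2 + (QK x)\<^sup>2)"
| "QK (inverse x) = - QK x / ((QRe x)\<^sup>2 + (QI x)\<^sup>2 + (QJ x)\<^sup>2 + (QK x)\<^sup>2)"

definition "x div y = x * inverse y" for x y :: quat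

instance
proof
  fix x y :: quat
  show "x div y = x * inverse y"
    by (rule divide_quat_def)
  show "inverse (0 :: quat) = 0"
    by (simp add: quat_eq_iff)
  assume "x \<noteq> 0"
  define n where "n = (QRe x)\<^sup>2 + (QI x)\<^sup>2 + (QJ x)\<^sup>2 + (QK x)\<^sup>2"
  define c where "c = Quat (QRe x) (- QI x) (- QJ x) (- QK x)"
  have "n \<noteq> 0"
    using \<open>x \<noteq> 0\<close> by (simp add: n_def quat_sum_squares_eq_0_iff)
  moreover have "inverse x = (1 / n) *\<^sub>R c"
    by (simp add: quat_eq_iff n_def c_def)
  moreover have "c * x = n *\<^sub>R 1" "x * c = n *\<^sub>R 1"
    by (simp_all add: quat_eq_iff n_def c_def power2_eq_square)
  ultimately show "inverse x * x = 1" "x * inverse x = 1"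
    by simp_all
qed

end

text \<open>The Euclidean structure of \<open>\<real>\<^sup>4\<close>; the topology is the one given by the Euclidean distance.\<close>

instantiation quat :: real_inner
begin

definition inner_quat_def:
  "inner x y = QRe x * QRe y + QI x * QI y + QJ x * QJ y + QK x * QK y"

definition norm_quat_def:
  "norm x = sqrt ((QRe x)\<^sup>2 + (QI x)\<^sup>2 + (QJ x)\<^sup>2 + (QK x)\<^sup>2)"

definition sgn_quat_def: "sgn (x :: quat) = x /\<^sub>R norm x"

definition dist_quat_def: "dist x y = norm (x - y)" for x y :: quat

definition uniformity_quat_def [code del]:
  "(uniformity :: (quat \<times> quat) filter) = (INF e\<in>{0 <..}. principal {(x, y). dist x y < e})"

definition open_quat_def [code del]:
  "open (U :: quat set) \<longleftrightarrow> (\<forall>x\<in>U. eventually (\<lambda>(x', y). x' = x \<longrightarrow> y \<in> U) uniformity)"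

instance
proof
  fix x y z :: quat and r :: real
  show "inner x y = inner y x"
    by (simp add: inner_quat_def mult.commute)
  show "inner (x + y) z = inner x z + inner y z"
    by (simp add: inner_quat_def algebra_simps)
  show "inner (scaleR r x) y = r * inner x y"
    by (simp add: inner_quat_def algebra_simps)
  show "0 \<le> inner x x"
    by (simp add: inner_quat_def)
  show "inner x x = 0 \<longleftrightarrow> x = 0"
    using quat_sum_squares_eq_0_iff [of x] by (simp add: inner_quat_def power2_eq_square)
  show "norm x = sqrt (inner x x)"
    by (simp add: inner_quat_def norm_quat_def power2_eq_square)
qed (rule sgn_quat_def dist_quat_def open_quat_def uniformity_quat_def)+

end

instance quat :: real_normed_div_algebra
proof
  fix x y :: quat
  have "(a*e - b*f - c*g - d*h)\<^sup>2 + (a*f + b*e + c*h - d*g)\<^sup>2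
      + (a*g - b*h + c*e + d*f)\<^sup>2 + (a*h + b*g - c*f + d*e)\<^sup>2
    = (a\<^sup>2 + b\<^sup>2 + c\<^sup>2 + d\<^sup>2) * (e\<^sup>2 + f\<^sup>2 + g\<^sup>2 + h\<^sup>2)"
    for a b c d e f g h :: real
    by (simp only: power2_eq_square) (simp add: algebra_simps)
  then show "norm (x * y) = norm x * norm y"
    by (simp only: norm_quat_def times_quat.sel real_sqrt_mult [symmetric])
qed

instantiation quat :: euclidean_space
begin

definition Basis_quat_def:
  "Basis = {Quat 1 0 0 0, Quat 0 1 0 0, Quat 0 0 1 0, Quat 0 0 0 1}"

instance
proof
  fix u v x :: quat
  show "(Basis :: quat set) \<noteq> {}" "finite (Basis :: quat set)"
    by (simp_all add: Basis_quat_def)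
  show "(\<forall>u\<in>Basis. inner x u = 0) \<longleftrightarrow> x = 0"
    by (simp add: Basis_quat_def inner_quat_def quat_eq_iff [of x 0])
  assume "u \<in> Basis" "v \<in> Basis"
  then show "inner u v = (if u = v then 1 else 0)"
    unfolding Basis_quat_def by (elim insertE emptyE) (simp_all add: inner_quat_def)
qed

end

lemma DIM_quat [simp]: "DIM(quat) = 4"
  by (simp add: Basis_quat_def)

lemma quat_units_mult:
  defines "i \<equiv> Quat 0 1 0 0" and "j \<equiv> Quat 0 0 1 0" and "k \<equiv> Quat 0 0 0 1"
  shows "i * i = -1" "j * j = -1" "k * k = -1"
    and "i * j = k" "j * k = i" "k * i = j"
    and "j * i = -k" "k * j = -i" "i * k = -j"
  by (simp_all add: i_def j_def k_def quat_eq_iff)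


section \<open>Entire slice regular functions\<close>

text \<open>Multiplication is not commutative: the coefficients stand to the right of the powers of \<open>q\<close>.\<close>

definition entire_slice_regular :: "(quat \<Rightarrow> quat) \<Rightarrow> bool" where
  "entire_slice_regular f \<longleftrightarrow> (\<exists>a :: nat \<Rightarrow> quat. \<forall>q. (\<lambda>k. q ^ k * a k) sums f q)"

end

theory Submission
  imports Defs "HOL-Complex_Analysis.Cauchy_Integral_Formula"
begin

text \<open>
  On each sphere \<open>x + y S\<close>, where \<open>S\<close> is the set of imaginary units, a slice regular function has
  the form \<open>f (x + y I) = A + I B\<close>, where \<open>A\<close> and \<open>B\<close> are the real and imaginary parts, at
  \<open>z = x + i y\<close>, of four entire functions \<open>P, Q, R, T\<close> of one complex variable (one for each real
  component of the coefficients). Its symmetrization is \<open>s = P\<^sup>2 + Q\<^sup>2 + R\<^sup>2 + T\<^sup>2\<close>, and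
  \<open>\<bar>s z\<bar>\<^sup>2\<close> is the product of the minimum and the maximum of \<open>\<bar>f\<bar>\<^sup>2\<close> over the sphere.

  If the image misses a ball, we may take its centre to be \<open>0\<close>, so \<open>\<bar>f\<bar> \<ge> e > 0\<close>. Then \<open>s\<close> has
  no zeros and \<open>P / s, Q / s, R / s, T / s\<close> are bounded, hence constant by Liouville's theorem.
  Substituting \<open>P = c s\<close> etc. in the definition of \<open>s\<close> yields \<open>s = d s\<^sup>2\<close>, so \<open>s\<close> is constant,
  and with it \<open>P, Q, R, T\<close> and \<open>f\<close>.
\<close>

section \<open>Imaginary units and complex slices\<close>

lemma quat_imaginary_unit_square:
  fixes I :: quat
  assumes "QRe I = 0" "norm I = 1"
  shows "I * I = -1"
proof -
  have "(QI I)\<^sup>2 + (QJ I)\<^sup>2 + (QK I)\<^sup>2 = 1"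
    using assms by (simp add: norm_quat_def)
  then show ?thesis
    using assms by (simp add: quat_eq_iff power2_eq_square algebra_simps)
qed

lemma quat_polar_form:
  fixes q :: quat
  obtains I x y where "QRe I = 0" "norm I = 1" "q = of_real x + y *\<^sub>R I"
proof -
  define v where "v = Quat 0 (QI q) (QJ q) (QK q)"
  have q: "q = of_real (QRe q) + v"
    by (simp add: v_def quat_eq_iff of_real_def)
  show thesis
  proof (cases "v = 0")
    case True
    then show ?thesis
      using that[of "Quat 0 1 0 0" "QRe q" 0] q by (simp add: norm_quat_def)
  next
    case False
    then show ?thesis
      using that[of "v /\<^sub>R norm v" "QRe q" "norm v"] q by (simp add: v_def)
  qed
qed

text \<open>As \<open>I\<close> squares to \<open>-1\<close>, the real span of \<open>1\<close> and
  \<open>I\<close> is a copy of the complex numbers, and powers can be computed there.\<close>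

lemma slice_power:
  fixes I :: "'a::real_algebra_1"
  assumes "I * I = -1"
  shows "(of_real (Re z) + Im z *\<^sub>R I) ^ n = of_real (Re (z ^ n)) + Im (z ^ n) *\<^sub>R I"
proof (induction n)
  case (Suc n)
  then show ?case
    by (simp add: algebra_simps of_real_def assms)
qed simp

section \<open>Splitting into four entire functions\<close>

lemma sums_Quat:
  assumes "f sums a" "g sums b" "h sums c" "k sums d"
  shows "(\<lambda>n. Quat (f n) (g n) (h n) (k n)) sums Quat a b c d"
proof -
  have Quat: "Quat u v w x = u *\<^sub>R Quat 1 0 0 0 + v *\<^sub>R Quat 0 1 0 0
      + w *\<^sub>R Quat 0 0 1 0 + x *\<^sub>R Quat 0 0 0 1" for u v w x
    by (simp add: quat_eq_iff)
  show ?thesis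
    unfolding Quat[of "f _"] Quat[of a]
    by (intro sums_add bounded_linear.sums[OF bounded_linear_scaleR_left] assms)
qed

text \<open>Convergence at all real points forces an infinite radius of convergence. That
  \<open>P 0\<close> is real later removes the dependence on the imaginary unit.\<close>

lemma entire_power_series_of_real_coeffs:
  fixes c :: "nat \<Rightarrow> real"
  assumes "\<And>x. summable (\<lambda>n. c n * x ^ n)"
  obtains P :: "complex \<Rightarrow> complex"
  where "P holomorphic_on UNIV" "P 0 \<in> \<real>" "\<And>z. (\<lambda>n. of_real (c n) * z ^ n) sums P z"
proof -
  define P where "P z = (\<Sum>n. of_real (c n) * z ^ n)" for z :: complex
  have "summable (\<lambda>n. of_real (c n) * z ^ n)" for z :: complex
  proof (rule powser_inside)
    show "summable (\<lambda>n. of_real (c n) * of_real (norm z + 1) ^ n :: complex)"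
      using summable_of_real[OF assms[of "norm z + 1"]] by simp
    show "norm z < norm (of_real (norm z + 1) :: complex)"
      by (simp only: norm_of_real)
  qed
  then have sums: "(\<lambda>n. of_real (c n) * z ^ n) sums P z" for z
    by (simp add: P_def summable_sums)
  have "P holomorphic_on ball 0 r" for r
    by (rule power_series_holomorphic) (use sums in simp)
  then have "P field_differentiable at z" for z
    by (rule holomorphic_on_imp_differentiable_at[of _ "ball 0 (norm z + 1)"]) auto
  then have "P holomorphic_on UNIV"
    by (simp add: holomorphic_on_def field_differentiable_at_within)
  moreover have "P 0 = of_real (c 0)"
    using sums_unique2[OF sums[of 0] powser_sums_zero] .
  ultimately show thesis
    using that sums by simp
qed

text \<open>Powers stand to the left of the coefficients, so \<open>I\<close> factors out on the
  left; what remains are real multiples of the coefficients, summed componentwise independently of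
  \<open>I\<close>.\<close>

lemma entire_slice_regular_components:
  assumes "entire_slice_regular f"
  obtains P Q R T :: "complex \<Rightarrow> complex"
  where "P holomorphic_on UNIV" "Q holomorphic_on UNIV" "R holomorphic_on UNIV" "T holomorphic_on UNIV"
    and "P 0 \<in> \<real>" "Q 0 \<in> \<real>" "R 0 \<in> \<real>" "T 0 \<in> \<real>"
    and "\<And>I z. QRe I = 0 \<Longrightarrow> norm I = 1 \<Longrightarrow> f (of_real (Re z) + Im z *\<^sub>R I)
      = Quat (Re (P z)) (Re (Q z)) (Re (R z)) (Re (T z))
        + I * Quat (Im (P z)) (Im (Q z)) (Im (R z)) (Im (T z))"
proof -
  obtain a where a: "\<And>q. (\<lambda>k. q ^ k * a k) sums f q"
    using assms by (auto simp: entire_slice_regular_def)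
  \<comment> \<open>At a real point each power is a scalar, so pairing with a basis vector
    \<open>e\<close> gives the real series of one component.\<close>
  have summ: "summable (\<lambda>k. inner (a k) e * x ^ k)" for e x
  proof -
    have "(\<lambda>k. inner (of_real x ^ k * a k) e) sums inner (f (of_real x)) e"
      by (rule bounded_linear.sums[OF bounded_linear_inner_left a])
    moreover have "of_real x ^ k * a k = x ^ k *\<^sub>R a k" for k
      by (simp add: scaleR_conv_of_real)
    ultimately show ?thesis
      by (simp add: sums_iff mult.commute)
  qed
  have 1: "summable (\<lambda>k. QRe (a k) * x ^ k)" for x
    using summ[of "Quat 1 0 0 0" x] by (simp add: inner_quat_def)
  have 2: "summable (\<lambda>k. QI (a k) * x ^ k)" for x
    using summ[of "Quat 0 1 0 0" x] by (simp add: inner_quat_def)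
  have 3: "summable (\<lambda>k. QJ (a k) * x ^ k)" for x
    using summ[of "Quat 0 0 1 0" x] by (simp add: inner_quat_def)
  have 4: "summable (\<lambda>k. QK (a k) * x ^ k)" for x
    using summ[of "Quat 0 0 0 1" x] by (simp add: inner_quat_def)
  obtain P where P: "P holomorphic_on UNIV" "P 0 \<in> \<real>"
      "\<And>z. (\<lambda>n. of_real (QRe (a n)) * z ^ n) sums P z"
    using entire_power_series_of_real_coeffs[OF 1] by blast
  obtain Q where Q: "Q holomorphic_on UNIV" "Q 0 \<in> \<real>"
      "\<And>z. (\<lambda>n. of_real (QI (a n)) * z ^ n) sums Q z"
    using entire_power_series_of_real_coeffs[OF 2] by blast
  obtain R where R: "R holomorphic_on UNIV" "R 0 \<in> \<real>"
      "\<And>z. (\<lambda>n. of_real (QJ (a n)) * z ^ n) sums R z"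
    using entire_power_series_of_real_coeffs[OF 3] by blast
  obtain T where T: "T holomorphic_on UNIV" "T 0 \<in> \<real>"
      "\<And>z. (\<lambda>n. of_real (QK (a n)) * z ^ n) sums T z"
    using entire_power_series_of_real_coeffs[OF 4] by blast
  have "f (of_real (Re z) + Im z *\<^sub>R I)
      = Quat (Re (P z)) (Re (Q z)) (Re (R z)) (Re (T z))
        + I * Quat (Im (P z)) (Im (Q z)) (Im (R z)) (Im (T z))"
    if I: "QRe I = 0" "norm I = 1" for I z
  proof -
    have re: "(\<lambda>k. Re (z ^ k) *\<^sub>R a k) sums Quat (Re (P z)) (Re (Q z)) (Re (R z)) (Re (T z))"
    proof -
      have "Re (z ^ k) *\<^sub>R a k = Quat (Re (of_real (QRe (a k)) * z ^ k)) (Re (of_real (QI (a k)) * z ^ k))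
          (Re (of_real (QJ (a k)) * z ^ k)) (Re (of_real (QK (a k)) * z ^ k))" for k
        by (simp add: quat_eq_iff)
      then show ?thesis
        by (simp only:) (intro sums_Quat sums_Re P Q R T)
    qed
    have im: "(\<lambda>k. Im (z ^ k) *\<^sub>R a k) sums Quat (Im (P z)) (Im (Q z)) (Im (R z)) (Im (T z))"
    proof -
      have "Im (z ^ k) *\<^sub>R a k = Quat (Im (of_real (QRe (a k)) * z ^ k)) (Im (of_real (QI (a k)) * z ^ k))
          (Im (of_real (QJ (a k)) * z ^ k)) (Im (of_real (QK (a k)) * z ^ k))" for k
        by (simp add: quat_eq_iff)
      then show ?thesis
        by (simp only:) (intro sums_Quat sums_Im P Q R T)
    qed
    have "(of_real (Re z) + Im z *\<^sub>R I) ^ k * a k = Re (z ^ k) *\<^sub>R a k + I * (Im (z ^ k) *\<^sub>R a k)" for k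
      by (simp add: slice_power[OF quat_imaginary_unit_square[OF I]] distrib_right scaleR_conv_of_real[of _ "a k"])
        (simp add: of_real_def)
    then have "(\<lambda>k. (of_real (Re z) + Im z *\<^sub>R I) ^ k * a k) sums
        (Quat (Re (P z)) (Re (Q z)) (Re (R z)) (Re (T z))
          + I * Quat (Im (P z)) (Im (Q z)) (Im (R z)) (Im (T z)))"
      using sums_add[OF re bounded_linear.sums[OF bounded_linear_mult_right[of I] im]] by simp
    then show ?thesis
      using a sums_unique2 by blast
  qed
  with P Q R T show thesis
    using that by blast
qed

section \<open>The norm on a sphere and the symmetrization\<close>

text \<open>
  For imaginary units \<open>I\<close>, \<open>\<bar>A + I B\<bar>\<^sup>2 = \<bar>A\<bar>\<^sup>2 + \<bar>B\<bar>\<^sup>2 + 2 \<langle>V, I\<rangle>\<close>, where \<open>V\<close> is the imaginary part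
  of \<open>A\<close> times the conjugate of \<open>B\<close>; the minimum is attained at \<open>I = - V / \<bar>V\<bar>\<close>.
\<close>
lemma sphere_norm_bound:
  fixes p q r t :: complex
  defines "A \<equiv> Quat (Re p) (Re q) (Re r) (Re t)" and "B \<equiv> Quat (Im p) (Im q) (Im r) (Im t)"
  assumes "e \<ge> 0"
    and lower: "\<And>I. QRe I = 0 \<Longrightarrow> norm I = 1 \<Longrightarrow> e \<le> norm (A + I * B)"
  defines "N \<equiv> (norm p)\<^sup>2 + (norm q)\<^sup>2 + (norm r)\<^sup>2 + (norm t)\<^sup>2"
  shows "e\<^sup>2 \<le> N" and "e\<^sup>2 * N \<le> (norm (p\<^sup>2 + q\<^sup>2 + r\<^sup>2 + t\<^sup>2))\<^sup>2"
proof -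
  define V where "V = Quat 0 (QI A * QRe B - QRe A * QI B - QJ A * QK B + QK A * QJ B)
    (QJ A * QRe B - QRe A * QJ B - QK A * QI B + QI A * QK B)
    (QK A * QRe B - QRe A * QK B - QI A * QJ B + QJ A * QI B)"
  have N: "(norm A)\<^sup>2 + (norm B)\<^sup>2 = N"
    by (simp add: A_def B_def N_def norm_quat_def cmod_power2)
  have expand: "(norm (A + I * B))\<^sup>2 = N + 2 * inner V I" if "QRe I = 0" "norm I = 1" for I
  proof -
    \<comment> \<open>Right multiplication by the conjugate of \<open>B\<close> is adjoint to that
      by \<open>B\<close>; the real part of the product drops out since
      \<open>QRe I = 0\<close>.\<close>
    have "inner A (I * B) = inner V I"
      using that by (simp add: inner_quat_def V_def algebra_simps)
    then have "(norm (A + I * B))\<^sup>2 = (norm A)\<^sup>2 + (norm (I * B))\<^sup>2 + 2 * inner V I"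
      by (simp add: power2_norm_eq_inner inner_add_left inner_add_right inner_commute)
    with that N show ?thesis
      by (simp add: norm_mult)
  qed
  have min: "e\<^sup>2 \<le> N - 2 * norm V"
  proof (cases "V = 0")
    case True
    then show ?thesis
      using expand[of "Quat 0 1 0 0"] power_mono[OF lower[of "Quat 0 1 0 0"] \<open>e \<ge> 0\<close>, of 2]
      by (simp add: norm_quat_def[of "Quat _ _ _ _"])
  next
    case False
    define I where "I = - (V /\<^sub>R norm V)"
    have I: "QRe I = 0" "norm I = 1"
      using False by (simp_all add: I_def V_def)
    have "inner V I = - norm V"
      using False by (simp add: I_def dot_square_norm power2_eq_square)
    then show ?thesis
      using expand[OF I] power_mono[OF lower[OF I] \<open>e \<ge> 0\<close>, of 2] by simp
  qed
  then show "e\<^sup>2 \<le> N"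
    by (smt (verit) norm_ge_zero)
  \<comment> \<open>The sum of squares has real part
    \<open>(norm A)\<^sup>2 - (norm B)\<^sup>2\<close> and imaginary part
    \<open>2 * inner A B\<close>.\<close>
  have "(norm (p\<^sup>2 + q\<^sup>2 + r\<^sup>2 + t\<^sup>2))\<^sup>2 = ((norm A)\<^sup>2 - (norm B)\<^sup>2)\<^sup>2 + 4 * (inner A B)\<^sup>2"
    by (simp add: cmod_power2 A_def B_def norm_quat_def inner_quat_def)
      (simp add: power2_eq_square algebra_simps)
  also have "\<dots> = N\<^sup>2 - 4 * ((norm A)\<^sup>2 * (norm B)\<^sup>2 - (inner A B)\<^sup>2)"
    unfolding N[symmetric] by (simp add: power2_eq_square algebra_simps)
  \<comment> \<open>Multiplicativity of the norm: \<open>A\<close> times the conjugate of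
    \<open>B\<close> has real part \<open>inner A B\<close> and imaginary part
    \<open>V\<close>.\<close>
  also have "(norm A)\<^sup>2 * (norm B)\<^sup>2 - (inner A B)\<^sup>2 = (norm V)\<^sup>2"
    by (simp add: V_def norm_quat_def inner_quat_def) (simp add: power2_eq_square algebra_simps)
  also have "N\<^sup>2 - 4 * (norm V)\<^sup>2 = (N - 2 * norm V) * (N + 2 * norm V)"
    by (simp add: power2_eq_square algebra_simps)
  also have "\<dots> \<ge> e\<^sup>2 * N"
    using min order_trans[OF zero_le_power2 min] order_trans[OF zero_le_power2 \<open>e\<^sup>2 \<le> N\<close>]
    by (intro mult_mono) simp_all
  finally show "e\<^sup>2 * N \<le> (norm (p\<^sup>2 + q\<^sup>2 + r\<^sup>2 + t\<^sup>2))\<^sup>2" .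
qed

section \<open>Liouville's theorem and constancy\<close>

text \<open>The quotient of \<open>P\<close> by \<open>s\<close> is entire with norm at most
  \<open>1 / e\<close>, hence constant.\<close>

lemma entire_multiple_of_dominating:
  fixes P s :: "complex \<Rightarrow> complex"
  assumes "P holomorphic_on UNIV" "s holomorphic_on UNIV" "\<And>z. s z \<noteq> 0" "e > 0"
    and bound: "\<And>z. e\<^sup>2 * (norm (P z))\<^sup>2 \<le> (norm (s z))\<^sup>2"
  obtains c where "\<And>z. P z = c * s z"
proof -
  have "norm (P z / s z) \<le> 1 / e" for z
  proof -
    have "(e * norm (P z))\<^sup>2 \<le> (norm (s z))\<^sup>2"
      using bound by (simp add: power_mult_distrib)
    then have "e * norm (P z) \<le> norm (s z)"
      by (rule power2_le_imp_le) simp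
    then show ?thesis
      using \<open>e > 0\<close> assms(3)[of z] by (simp add: norm_divide field_simps)
  qed
  then have "bounded (range (\<lambda>z. P z / s z))"
    by (auto simp: bounded_iff)
  moreover have "(\<lambda>z. P z / s z) holomorphic_on UNIV"
    by (intro holomorphic_intros assms)
  ultimately have "(\<lambda>z. P z / s z) constant_on UNIV"
    by (rule Liouville_theorem[rotated])
  then obtain c where "\<And>z. P z / s z = c"
    by (auto simp: constant_on_def)
  then have "P z = c * s z" for z
    using assms(3)[of z] by (metis nonzero_divide_eq_eq)
  then show thesis
    using that by blast
qed

lemma entire_slice_regular_bounded_below_imp_constant:
  assumes "entire_slice_regular f" "e > 0" and lower: "\<And>q. e \<le> norm (f q)"
  shows "f constant_on UNIV"
proof -
  obtain P Q R T :: "complex \<Rightarrow> complex"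
    where hol: "P holomorphic_on UNIV" "Q holomorphic_on UNIV" "R holomorphic_on UNIV" "T holomorphic_on UNIV"
      and real: "P 0 \<in> \<real>" "Q 0 \<in> \<real>" "R 0 \<in> \<real>" "T 0 \<in> \<real>"
      and f: "\<And>I z. QRe I = 0 \<Longrightarrow> norm I = 1 \<Longrightarrow> f (of_real (Re z) + Im z *\<^sub>R I)
        = Quat (Re (P z)) (Re (Q z)) (Re (R z)) (Re (T z))
          + I * Quat (Im (P z)) (Im (Q z)) (Im (R z)) (Im (T z))"
    using entire_slice_regular_components[OF assms(1)] by blast
  define s where "s z = (P z)\<^sup>2 + (Q z)\<^sup>2 + (R z)\<^sup>2 + (T z)\<^sup>2" for z
  define N where "N z = (norm (P z))\<^sup>2 + (norm (Q z))\<^sup>2 + (norm (R z))\<^sup>2 + (norm (T z))\<^sup>2" for z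
  have bound: "e\<^sup>2 \<le> N z" "e\<^sup>2 * N z \<le> (norm (s z))\<^sup>2" for z
    unfolding N_def s_def using \<open>e > 0\<close> lower f
    by (intro sphere_norm_bound; metis less_imp_le)+
  have s_nz: "s z \<noteq> 0" for z
  proof
    assume "s z = 0"
    moreover have "0 < e\<^sup>2 * e\<^sup>2"
      using \<open>e > 0\<close> by simp
    moreover have "e\<^sup>2 * e\<^sup>2 \<le> e\<^sup>2 * N z"
      using bound(1) by (intro mult_left_mono) auto
    ultimately show False
      using bound(2)[of z] by (simp only: norm_zero zero_power2)
  qed
  have hol_s: "s holomorphic_on UNIV"
    unfolding s_def by (intro holomorphic_intros hol)
  have component_bound: "e\<^sup>2 * u \<le> (norm (s z))\<^sup>2" if "u \<le> N z" for u z
    using bound(2)[of z] mult_left_mono[OF that, of "e\<^sup>2"] by simp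
  note multiple = entire_multiple_of_dominating[OF _ hol_s s_nz \<open>e > 0\<close> component_bound]
  obtain cP where cP: "\<And>z. P z = cP * s z"
    using multiple[OF hol(1)] by (auto simp: N_def)
  obtain cQ where cQ: "\<And>z. Q z = cQ * s z"
    using multiple[OF hol(2)] by (auto simp: N_def)
  obtain cR where cR: "\<And>z. R z = cR * s z"
    using multiple[OF hol(3)] by (auto simp: N_def)
  obtain cT where cT: "\<And>z. T z = cT * s z"
    using multiple[OF hol(4)] by (auto simp: N_def)
  have "1 = (cP\<^sup>2 + cQ\<^sup>2 + cR\<^sup>2 + cT\<^sup>2) * s z" for z
  proof -
    have "s z = (cP\<^sup>2 + cQ\<^sup>2 + cR\<^sup>2 + cT\<^sup>2) * s z * s z"
      using s_def[of z] unfolding cP cQ cR cT by (simp add: power2_eq_square algebra_simps)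
    then show ?thesis
      using s_nz[of z] by (metis mult_cancel_right1)
  qed
  \<comment> \<open>The constant factor is nonzero, its product with \<open>s z\<close> being
    \<open>1\<close>, and can be cancelled.\<close>
  then have "s z = s 0" for z
    by (metis mult_cancel_left mult_zero_left zero_neq_one)
  then have const: "P z = P 0" "Q z = Q 0" "R z = R 0" "T z = T 0" for z
    by (metis cP cQ cR cT)+
  \<comment> \<open>With real values the term multiplied by \<open>I\<close> vanishes, so
    \<open>f\<close> takes the same value on all slices.\<close>
  have im: "Im (P 0) = 0" "Im (Q 0) = 0" "Im (R 0) = 0" "Im (T 0) = 0"
    using real by (simp_all add: complex_is_Real_iff)
  have zero: "Quat 0 0 0 0 = 0"
    by (simp add: quat_eq_iff)
  have "f q = Quat (Re (P 0)) (Re (Q 0)) (Re (R 0)) (Re (T 0))" for q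
  proof -
    obtain I x y where I: "QRe I = 0" "norm I = 1" and q: "q = of_real x + y *\<^sub>R I"
      by (rule quat_polar_form)
    show ?thesis
      using f[OF I, of "Complex x y"] unfolding const[of "Complex x y"] im zero q by simp
  qed
  then show ?thesis
    by (auto simp: constant_on_def)
qed

text \<open>Only the coefficient at \<open>k = 0\<close> changes. This moves the centre of an
  omitted ball to \<open>0\<close>.\<close>

lemma entire_slice_regular_diff_const:
  assumes "entire_slice_regular f"
  shows "entire_slice_regular (\<lambda>q. f q - c)"
proof -
  obtain a where a: "\<And>q. (\<lambda>k. q ^ k * a k) sums f q"
    using assms by (auto simp: entire_slice_regular_def)
  have "(\<lambda>k. q ^ k * (a k - (if k = 0 then c else 0))) sums (f q - c)" for q
  proof -
    have "q ^ k * (if k = 0 then c else 0) = (if k = 0 then c else 0)" for k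
      by simp
    then show ?thesis
      using sums_diff[OF a[of q] sums_single[of 0 "\<lambda>_. c"]] by (simp only: right_diff_distrib)
  qed
  then show ?thesis
    unfolding entire_slice_regular_def
    by (intro exI[of _ "\<lambda>k. a k - (if k = 0 then c else 0)"]) blast
qed

theorem proposition4p3:
  fixes f :: "quat \<Rightarrow> quat"
  assumes "entire_slice_regular f"
    and "\<not> f constant_on UNIV"
  shows "closure (range f) = UNIV"
proof (rule ccontr)
  assume "closure (range f) \<noteq> UNIV"
  then obtain c where "c \<notin> closure (range f)"
    by blast
  then obtain e where "e > 0" and "\<And>q. e \<le> norm (f q - c)"
    by (auto simp: closure_approachable dist_norm not_less)
  then have "(\<lambda>q. f q - c) constant_on UNIV"
    using entire_slice_regular_bounded_below_imp_constant entire_slice_regular_diff_const[OF assms(1)]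
    by blast
  then have "f constant_on UNIV"
    by (auto simp: constant_on_def algebra_simps)
  with assms(2) show False ..
qed

end
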